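(* Let $\mathcal H$ be a complex Hilbert space (of arbitrary dimension) and let $T$ be a bounded operator on $\mathcal H$ with $W(T)\subset\mathcal S_{\pi/4}=\{re^{i\theta}:r\ge0,\ |\theta|\le\pi/4\}$. For every $t\in[-1,1]$, $$\Bigl\|\bigl((T^2-I)^2-it(T^2+I)^2\bigr)\bigl((T^2+I)^2+it(T^2-I)^2\bigr)^{-1}\Bigr\|\le\sqrt2,$$ where at $t=\pm1$ the common polynomial factor is cancelled before evaluation. Equivalently, with $w=(T^2-I)(T^2+I)^{-1}$, one has $\|h_c(w)\|\le\sqrt2$ on the full diameter $c=it$, $|t|\le1$, where $$h_c(w)=\frac{w^2+\bar c}{1+cw^2}.$$
   Context: $W(T)=\{\langle Tx,x\rangle:\|x\|=1\}$ is the numerical range. For $t=\pm1$ the displayed quotient is understood as the rational function of $T$ obtained after cancelling the common polynomial factor of numerator and denominator (it is then a constant), and likewise for $h_{\pm i}(w)$. *)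

theory Defs
  imports "HOL-Analysis.Analysis" "HOL-Computational_Algebra.Computational_Algebra"
    "HOL-Computational_Algebra.Field_as_Ring"
begin

text \<open>
  Complex Hilbert spaces, as a type class on top of the real inner product spaces of HOL-Analysis.
  The complex inner product is linear in its first argument; the underlying real inner product is
  its real part, so that norm and topology are the ones it induces.  The dimension is arbitrary
  (the zero space is included).
\<close>

class complex_inner = real_inner +
  fixes scaleC :: "complex \<Rightarrow> 'a \<Rightarrow> 'a"  (infixr "*\<^sub>C" 75)
    and cinner :: "'a \<Rightarrow> 'a \<Rightarrow> complex"
  assumes scaleC_add_right: "a *\<^sub>C (x + y) = a *\<^sub>C x + a *\<^sub>C y"
    and scaleC_add_left: "(a + b) *\<^sub>C x = a *\<^sub>C x + b *\<^sub>C x"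
    and scaleC_scaleC: "a *\<^sub>C (b *\<^sub>C x) = (a * b) *\<^sub>C x"
    and scaleR_scaleC: "scaleR r x = complex_of_real r *\<^sub>C x"
    and cinner_add_left: "cinner (x + y) z = cinner x z + cinner y z"
    and cinner_scaleC_left: "cinner (a *\<^sub>C x) y = a * cinner x y"
    and cinner_commute: "cinner x y = cnj (cinner y x)"
    and Re_cinner: "Re (cinner x y) = inner x y"

class chilbert_space = complex_inner + complete_space

instantiation complex :: chilbert_space
begin

definition scaleC_complex :: "complex \<Rightarrow> complex \<Rightarrow> complex"
  where "scaleC_complex = (*)"

definition cinner_complex :: "complex \<Rightarrow> complex \<Rightarrow> complex"
  where "cinner_complex x y = x * cnj y"

instance
  by standard (auto simp: scaleC_complex_def cinner_complex_def algebra_simps scaleR_conv_of_real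
      inner_complex_def)

end

lemma cinner_self: "cinner x x = complex_of_real ((norm x)\<^sup>2)"
proof -
  have "Im (cinner x x) = 0"
    using cinner_commute[of x x] by (metis complex_cnj_cancel_iff Reals_cnj_iff complex_is_Real_iff)
  then show ?thesis
    by (simp add: complex_eq_iff Re_cinner power2_norm_eq_inner)
qed

lemma scaleC_one [simp]: "1 *\<^sub>C x = (x :: 'a :: complex_inner)"
  using scaleR_scaleC[of 1 x] by simp

lemma scaleC_zero_left [simp]: "0 *\<^sub>C x = (0 :: 'a :: complex_inner)"
  using scaleR_scaleC[of 0 x] by simp

lemma scaleC_zero_right [simp]: "c *\<^sub>C 0 = (0 :: 'a :: complex_inner)"
  using scaleC_add_right[of c 0 0] by simp

lemma scaleC_minus_left [simp]: "(- c) *\<^sub>C x = - (c *\<^sub>C (x :: 'a :: complex_inner))"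
  using scaleC_add_left[of c "- c" x] by (simp add: eq_neg_iff_add_eq_0 add.commute)

lemma scaleC_sum_right: "c *\<^sub>C sum f A = (\<Sum>i\<in>A. c *\<^sub>C (f i :: 'a :: complex_inner))"
  by (induction A rule: infinite_finite_induct) (simp_all add: scaleC_add_right)


text \<open>
  Bounded operators are functions; their norm is \<^const>\<open>onorm\<close>.  The predicate
  \<^const>\<open>bounded_linear\<close> only speaks about real scalars.
\<close>

definition bounded_clinear :: "('a :: complex_inner \<Rightarrow> 'b :: complex_inner) \<Rightarrow> bool"
  where "bounded_clinear A \<longleftrightarrow> bounded_linear A \<and> (\<forall>c x. A (c *\<^sub>C x) = c *\<^sub>C A x)"

definition bounded_invertible :: "('a :: complex_inner \<Rightarrow> 'a) \<Rightarrow> bool"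
  where "bounded_invertible A \<longleftrightarrow> bounded_clinear A \<and> bij A \<and> bounded_clinear (inv A)"

definition numerical_range :: "('a :: complex_inner \<Rightarrow> 'a) \<Rightarrow> complex set"
  where "numerical_range A = {cinner (A x) x | x. norm x = 1}"

definition sector :: "real \<Rightarrow> complex set"
  where "sector \<alpha> = {complex_of_real r * cis \<theta> | r \<theta>. r \<ge> 0 \<and> \<bar>\<theta>\<bar> \<le> \<alpha>}"

definition poly_op :: "complex poly \<Rightarrow> ('a :: complex_inner \<Rightarrow> 'a) \<Rightarrow> 'a \<Rightarrow> 'a"
  where "poly_op p A = (\<lambda>x. \<Sum>i\<le>degree p. coeff p i *\<^sub>C (A ^^ i) x)"

text \<open>
  A rational function of an operator.  The function \<^const>\<open>quot_of_fract\<close> returns numerator and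
  denominator in lowest terms, so common polynomial factors are cancelled before the operator is
  substituted; by \<open>rat_op_coprime\<close> below this changes nothing if there are none.
  The value is meaningful under \<open>rat_op_defined\<close>.
\<close>

definition rat_op_defined :: "complex poly fract \<Rightarrow> ('a :: complex_inner \<Rightarrow> 'a) \<Rightarrow> bool"
  where "rat_op_defined r A \<longleftrightarrow> bounded_invertible (poly_op (snd (quot_of_fract r)) A)"

definition rat_op :: "complex poly fract \<Rightarrow> ('a :: complex_inner \<Rightarrow> 'a) \<Rightarrow> 'a \<Rightarrow> 'a"
  where "rat_op r A = poly_op (fst (quot_of_fract r)) A \<circ> inv (poly_op (snd (quot_of_fract r)) A)"

text \<open>\<open>h\<^sub>c(w) = (w\<^sup>2 + cnj c) / (1 + c w\<^sup>2)\<close> as a rational function of \<open>w\<close>.\<close>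

definition h_fract :: "complex \<Rightarrow> complex poly fract"
  where "h_fract c = (let w = [:0, 1:] in Fract (w\<^sup>2 + [:cnj c:]) (1 + smult c (w\<^sup>2)))"

lemma bounded_clinearD:
  assumes "bounded_clinear A"
  shows "A (x + y) = A x + A y" "A (x - y) = A x - A y" "A (c *\<^sub>C x) = c *\<^sub>C A x" "A 0 = 0"
    "A (- x) = - A x" "A (sum f S) = (\<Sum>i\<in>S. A (f i))"
proof -
  interpret bounded_linear A
    using assms by (simp add: bounded_clinear_def)
  show "A (x + y) = A x + A y" "A (x - y) = A x - A y" "A (c *\<^sub>C x) = c *\<^sub>C A x" "A 0 = 0"
    "A (- x) = - A x" "A (sum f S) = (\<Sum>i\<in>S. A (f i))"
    using assms by (simp_all add: bounded_clinear_def add diff zero neg sum)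
qed

lemma poly_op_eq_sum:
  assumes "degree p \<le> n"
  shows "poly_op p A x = (\<Sum>i\<le>n. coeff p i *\<^sub>C (A ^^ i) x)"
  unfolding poly_op_def
  by (rule sum.mono_neutral_left) (use assms in \<open>auto simp: coeff_eq_0\<close>)

lemma poly_op_0 [simp]: "poly_op 0 A x = 0"
  by (simp add: poly_op_def)

lemma poly_op_pCons:
  assumes "bounded_clinear A"
  shows "poly_op (pCons a p) A x = a *\<^sub>C x + A (poly_op p A x)"
proof -
  have "poly_op (pCons a p) A x = (\<Sum>i\<le>Suc (degree p). coeff (pCons a p) i *\<^sub>C (A ^^ i) x)"
    by (rule poly_op_eq_sum) (rule degree_pCons_le)
  also have "\<dots> = a *\<^sub>C x + (\<Sum>i\<le>degree p. coeff p i *\<^sub>C A ((A ^^ i) x))"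
    by (subst sum.atMost_Suc_shift) simp
  also have "\<dots> = a *\<^sub>C x + A (poly_op p A x)"
    by (simp add: poly_op_def bounded_clinearD[OF assms])
  finally show ?thesis .
qed

lemma poly_op_smult: "poly_op (smult c p) A x = c *\<^sub>C poly_op p A x"
  by (cases "c = 0") (simp_all add: poly_op_def scaleC_sum_right scaleC_scaleC)

lemma bounded_clinear_compose:
  "bounded_clinear A \<Longrightarrow> bounded_clinear B \<Longrightarrow> bounded_clinear (A \<circ> B)"
  by (auto simp: bounded_clinear_def o_def intro: bounded_linear_compose)

lemma norm_scaleC: "norm (c *\<^sub>C x) = cmod c * norm (x :: 'a :: complex_inner)"
proof -
  have "cinner (c *\<^sub>C x) (c *\<^sub>C x) = c * cnj c * cinner x x"
    by (metis cinner_commute cinner_scaleC_left complex_cnj_mult mult.assoc)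
  then have "complex_of_real ((norm (c *\<^sub>C x))\<^sup>2) = complex_of_real ((cmod c * norm x)\<^sup>2)"
    by (simp add: cinner_self power_mult_distrib flip: complex_norm_square)
  then show ?thesis
    unfolding of_real_eq_iff by (simp add: power2_eq_iff_nonneg)
qed

lemma bounded_clinear_scaleC: "bounded_clinear (\<lambda>x :: 'a :: complex_inner. c *\<^sub>C x)"
proof -
  have "bounded_linear (\<lambda>x :: 'a. c *\<^sub>C x)"
    by (rule bounded_linear_intro[where K = "cmod c"])
      (simp_all add: scaleC_add_right scaleR_scaleC scaleC_scaleC norm_scaleC mult.commute)
  then show ?thesis
    by (simp add: bounded_clinear_def scaleC_scaleC mult.commute)
qed

lemma quot_of_fract_coprime:
  fixes p q :: "complex poly"
  assumes "coprime p q" "q \<noteq> 0"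
  shows "\<exists>c. c \<noteq> 0 \<and> quot_of_fract (Fract p q) = (smult c p, smult c q)"
proof -
  obtain d where d: "p = fst (normalize_quot (p, q)) * d" "q = snd (normalize_quot (p, q)) * d"
      "d dvd p" "d dvd q" "d \<noteq> 0"
    using normalize_quotE[OF assms(2)] by blast
  have "is_unit d"
    using assms(1) d by (meson coprime_common_divisor)
  then obtain c where c: "d = [:c:]" "c \<noteq> 0"
    using d(5) by (auto simp: is_unit_poly_iff)
  have "quot_of_fract (Fract p q) = normalize_quot (p, q)"
    using assms(2) by transfer simp
  moreover have "p = smult c (fst (normalize_quot (p, q)))" "q = smult c (snd (normalize_quot (p, q)))"
    using d(1,2) c(1) by simp_all
  then have "fst (normalize_quot (p, q)) = smult (inverse c) p"
      "snd (normalize_quot (p, q)) = smult (inverse c) q"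
    using c(2) by (metis smult_smult left_inverse smult_1_left)+
  ultimately show ?thesis
    using c by (intro exI[of _ "inverse c"]) (simp add: prod_eq_iff)
qed

lemma inv_scaleC_comp:
  fixes A :: "'a :: complex_inner \<Rightarrow> 'a"
  assumes "c \<noteq> 0" "bij A"
  shows "inv (\<lambda>x. c *\<^sub>C A x) = inv A \<circ> (\<lambda>x. inverse c *\<^sub>C x)"
proof (rule inv_equality)
  fix x
  show "(inv A \<circ> (\<lambda>x. inverse c *\<^sub>C x)) (c *\<^sub>C A x) = x"
    using assms by (simp add: scaleC_scaleC bij_is_inj)
  show "c *\<^sub>C A ((inv A \<circ> (\<lambda>x. inverse c *\<^sub>C x)) x) = x"
    using assms by (simp add: scaleC_scaleC bij_is_surj surj_f_inv_f)
qed

lemma bounded_invertible_scaleC: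
  fixes A :: "'a :: complex_inner \<Rightarrow> 'a"
  assumes "c \<noteq> 0" "bounded_invertible A"
  shows "bounded_invertible (\<lambda>x. c *\<^sub>C A x)"
proof -
  have A: "bounded_clinear A" "bij A" "bounded_clinear (inv A)"
    using assms by (auto simp: bounded_invertible_def)
  have "bij ((\<lambda>x. c *\<^sub>C x) :: 'a \<Rightarrow> 'a)"
    using assms(1) by (intro o_bij[of "\<lambda>x. inverse c *\<^sub>C x"]) (auto simp: scaleC_scaleC o_def)
  then have "bij (\<lambda>x. c *\<^sub>C A x)"
    using bij_comp[OF A(2)] by (simp add: o_def)
  moreover have "bounded_clinear (\<lambda>x. c *\<^sub>C A x)"
    using bounded_clinear_compose[OF bounded_clinear_scaleC A(1)] by (simp add: o_def)
  ultimately show ?thesis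
    by (simp add: bounded_invertible_def inv_scaleC_comp[OF assms(1) A(2)]
        bounded_clinear_compose[OF A(3) bounded_clinear_scaleC])
qed

lemma rat_op_defined_coprime:
  assumes "coprime p q" "q \<noteq> 0"
  shows "rat_op_defined (Fract p q) A \<longleftrightarrow> bounded_invertible (poly_op q A)"
proof -
  obtain c where c: "c \<noteq> 0" "quot_of_fract (Fract p q) = (smult c p, smult c q)"
    using quot_of_fract_coprime[OF assms] by blast
  have "rat_op_defined (Fract p q) A \<longleftrightarrow> bounded_invertible (\<lambda>x. c *\<^sub>C poly_op q A x)"
    by (simp add: rat_op_defined_def c(2) poly_op_smult[abs_def])
  also have "\<dots> \<longleftrightarrow> bounded_invertible (poly_op q A)"
    using bounded_invertible_scaleC[OF c(1), of "poly_op q A"]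
      bounded_invertible_scaleC[of "inverse c" "\<lambda>x. c *\<^sub>C poly_op q A x"] c(1)
    by (auto simp: scaleC_scaleC)
  finally show ?thesis .
qed

lemma poly_op_scaleC:
  assumes "bounded_clinear A"
  shows "poly_op p A (c *\<^sub>C x) = c *\<^sub>C poly_op p A x"
  by (induction p)
    (simp_all add: poly_op_pCons[OF assms] bounded_clinearD[OF assms] scaleC_add_right
      scaleC_scaleC mult.commute)

lemma rat_op_coprime:
  assumes "coprime p q" "q \<noteq> 0" "bounded_clinear A" "bounded_invertible (poly_op q A)"
  shows "rat_op (Fract p q) A = poly_op p A \<circ> inv (poly_op q A)"
proof -
  obtain c where c: "c \<noteq> 0" "quot_of_fract (Fract p q) = (smult c p, smult c q)"
    using quot_of_fract_coprime[OF assms(1,2)] by blast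
  have q: "bij (poly_op q A)" "bounded_clinear (inv (poly_op q A))"
    using assms(4) by (auto simp: bounded_invertible_def)
  show ?thesis
    using c(1)
    by (simp add: rat_op_def c(2) poly_op_smult[abs_def] inv_scaleC_comp[OF c(1) q(1)] fun_eq_iff
        bounded_clinearD[OF q(2)] poly_op_scaleC[OF assms(3)] scaleC_scaleC)
qed

lemma poly_op_one [simp]: "poly_op 1 A = id"
  by (simp add: poly_op_def fun_eq_iff)

lemma poly_op_add: 
  assumes "bounded_clinear A"
  shows "poly_op (p + q) A x = poly_op p A x + poly_op q A x"
  by (induction p q rule: poly_induct2)
    (simp_all add: poly_op_pCons[OF assms] bounded_clinearD[OF assms] scaleC_add_left)

lemma poly_op_mult:
  assumes "bounded_clinear A"
  shows "poly_op (p * q) A x = poly_op p A (poly_op q A x)"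
  by (induction p)
    (simp_all add: poly_op_pCons[OF assms] poly_op_add[OF assms] poly_op_smult
      bounded_clinearD[OF assms])

text \<open>
  For \<open>\<bar>t\<bar> < 1\<close> there is no common factor, and at \<open>t = \<plusminus>1\<close> everything cancels.
\<close>

lemma quartics_coprime:
  fixes a b :: "complex poly"
  assumes "coprime a b" "\<bar>t\<bar> < 1"
  shows "coprime (a - smult (\<i> * complex_of_real t) b) (b + smult (\<i> * complex_of_real t) a)"
proof (rule coprimeI)
  fix d
  assume d: "d dvd a - smult (\<i> * t) b" "d dvd b + smult (\<i> * t) a"
  have t: "t\<^sup>2 < 1"
    using assms(2) by (simp add: abs_square_less_1)
  then have ne: "complex_of_real (1 - t\<^sup>2) \<noteq> 0"
    unfolding of_real_eq_0_iff by simp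
  have "(a - smult (\<i> * t) b) + smult (\<i> * t) (b + smult (\<i> * t) a) = smult (1 - t\<^sup>2) a"
    by (simp add: poly_eq_iff algebra_simps power2_eq_square)
  moreover have "(b + smult (\<i> * t) a) - smult (\<i> * t) (a - smult (\<i> * t) b) = smult (1 - t\<^sup>2) b"
    by (simp add: poly_eq_iff algebra_simps power2_eq_square)
  ultimately have "d dvd smult (1 - t\<^sup>2) a" "d dvd smult (1 - t\<^sup>2) b"
    using dvd_add[OF d(1) dvd_smult[OF d(2)]] dvd_diff[OF d(2) dvd_smult[OF d(1)]] by metis+
  then have "d dvd a" "d dvd b"
    using ne by (auto simp: dvd_smult_iff simp del: of_real_diff of_real_power)
  then show "is_unit d"
    using assms(1) by (meson coprime_common_divisor)
qed

lemma quartics_unit_circle: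
  fixes a b :: "complex poly"
  assumes "b + smult (\<i> * complex_of_real t) a \<noteq> 0" "t\<^sup>2 = 1"
  shows "Fract (a - smult (\<i> * t) b) (b + smult (\<i> * t) a) = Fract [:- \<i> * t:] 1"
proof -
  have "complex_of_real t * complex_of_real t = 1"
    using assms(2) by (metis of_real_1 of_real_mult power2_eq_square)
  then show ?thesis
    using assms(1) by (simp add: eq_fract algebra_simps smult_add_right power2_eq_square)
qed

end

theory Submission
  imports Defs
begin

text \<open>
  Fix \<open>t\<close>, put \<open>\<tau> = 1 + \<i> t\<close>, \<open>E = T\<^sup>4 + I\<close> and \<open>s = T\<^sup>2\<close>.  Numerator and denominator of the quotient are
  \<open>N = \<tau>\<^sup>* E - 2 \<tau> s\<close> and \<open>D = \<tau> E + 2 \<tau>\<^sup>* s\<close>, where the star denotes complex conjugation, so the claim is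
  that the quadratic form \<open>2 \<parallel>D x\<parallel>\<^sup>2 - \<parallel>N x\<parallel>\<^sup>2\<close> is nonnegative and that \<open>D\<close> is invertible
  for \<open>\<bar>t\<bar> < 1\<close>; for \<open>\<bar>t\<bar> = 1\<close> the cancelled quotient is a constant of modulus \<open>1\<close>.
  Expanding shows that \<open>1 + t\<^sup>2\<close> times this form is
  \<open>2 t\<^sup>2 \<parallel>D x\<parallel>\<^sup>2 + (1 - t\<^sup>2) (\<parallel>D x\<parallel>\<^sup>2 + 8 (1 + t\<^sup>2) Re \<langle>E x, s x\<rangle>)\<close>,
  and as \<open>\<bar>t\<bar> \<le> 1\<close> it suffices that the form multiplied by \<open>1 - t\<^sup>2\<close> is nonnegative.

  Formally, let \<open>U = T + T\<^sup>-\<^sup>1\<close> and \<open>y = T\<^sup>2 x\<close>, so that \<open>E x = (U\<^sup>2 - 2) y\<close>.  On the boundary of the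
  sector \<open>z + 1/z\<close> runs through one branch of the hyperbola \<open>Re u\<^sup>2 = 2\<close>, and the numerical range of
  \<open>U\<close> lies in the convex region bounded by that branch
  (\<open>numerical_range_add_inverse_hyperbola\<close>, which says \<open>Re \<langle>(\<epsilon> U - h) q, q\<rangle> \<ge> 0\<close> for every
  tangent line \<open>Re (\<epsilon> z) = h\<close> of the branch and every \<open>q = T r\<close>, so that \<open>T\<^sup>-\<^sup>1\<close> does not occur).  Write \<open>\<tau> = \<bar>\<tau>\<bar> \<epsilon>\<^sup>2\<close> with \<open>\<bar>\<epsilon>\<bar> = 1\<close>
  and \<open>h\<^sup>2 = 2 Re \<epsilon>\<^sup>2\<close>.  The tangent line belonging to \<open>\<epsilon>\<close> alone gives
  this form, divided by \<open>1 + t\<^sup>2\<close>, as a sum of nonnegative terms: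
  \<open>\<parallel>U\<^sup>2 y - 2 h \<epsilon>\<^sup>* U y + 2 h\<^sup>2 (\<epsilon>\<^sup>*)\<^sup>2 y\<parallel>\<^sup>2 + 4 h Re \<langle>(\<epsilon> U - h) U y, U y\<rangle>
      + 8 h\<^sup>3 Re \<langle>(\<epsilon> U - h) y, y\<rangle>\<close>.
  This is \<open>extremal_form_nonneg\<close>; \<open>quartic_norm_bound\<close> combines it with the expansion above.

  Invertibility is soft: a linear factor \<open>T - \<zeta>\<close> with \<open>\<zeta>\<close> outside the sector becomes coercive after
  multiplication by a suitable scalar, hence every polynomial in \<open>T\<close> without zeros in the sector is
  invertible (\<open>bounded_invertible_poly_op\<close>).  The statement about \<open>h\<^sub>c(w)\<close> follows because
  numerator and denominator of \<open>h\<^sub>c(w)\<close> are \<open>N\<close> and \<open>D\<close> composed with \<open>(T\<^sup>2 + I)\<^sup>-\<^sup>2\<close>.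
\<close>

section \<open>Sesquilinearity\<close>

lemma cinner_add_right: "cinner x (y + z) = cinner x y + cinner x (z :: 'a :: complex_inner)"
  by (metis cinner_add_left cinner_commute complex_cnj_add)

lemma cinner_scaleC_right: "cinner x (c *\<^sub>C y) = cnj c * cinner x (y :: 'a :: complex_inner)"
  by (metis cinner_commute cinner_scaleC_left complex_cnj_mult)

lemma cinner_minus_left: "cinner (- x) y = - cinner x (y :: 'a :: complex_inner)"
  using cinner_scaleC_left[of "-1" x y] by simp

lemma cinner_minus_right: "cinner x (- y) = - cinner x (y :: 'a :: complex_inner)"
  using cinner_scaleC_right[of x "-1" y] by simp

lemma cinner_diff_left: "cinner (x - y) z = cinner x z - cinner y (z :: 'a :: complex_inner)"
  using cinner_add_left[of x "- y" z] by (simp add: cinner_minus_left)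

lemma cinner_diff_right: "cinner x (y - z) = cinner x y - cinner x (z :: 'a :: complex_inner)"
  using cinner_add_right[of x y "- z"] by (simp add: cinner_minus_right)

lemmas sesquilinear = cinner_add_left cinner_add_right cinner_diff_left cinner_diff_right
  cinner_scaleC_left cinner_scaleC_right

lemma norm_square_eq_Re_cinner: "(norm x)\<^sup>2 = Re (cinner x (x :: 'a :: complex_inner))"
  by (simp add: cinner_self)

section \<open>The quadratic inequality on the sector\<close>

lemma abs_Im_le_Re_if_numerical_range_sector:
  fixes T :: "'a :: complex_inner \<Rightarrow> 'a"
  assumes T: "bounded_clinear T" and W: "numerical_range T \<subseteq> sector (pi / 4)"
  shows "\<bar>Im (cinner (T x) x)\<bar> \<le> Re (cinner (T x) x)"
proof (cases "x = 0")
  case True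
  then show ?thesis
    using cinner_scaleC_right[of "T 0" 0 0] by simp
next
  case False
  define y where "y = complex_of_real (inverse (norm x)) *\<^sub>C x"
  have x: "x = complex_of_real (norm x) *\<^sub>C y"
    using False by (simp add: y_def scaleC_scaleC)
  have "norm y = 1"
    using False by (simp add: y_def norm_scaleC norm_inverse)
  then have "cinner (T y) y \<in> sector (pi / 4)"
    using W unfolding numerical_range_def by blast
  then obtain r \<theta> where r: "cinner (T y) y = complex_of_real r * cis \<theta>" "r \<ge> 0" "\<bar>\<theta>\<bar> \<le> pi / 4"
    by (auto simp: sector_def)
  have c: "cos (pi / 4) \<le> cos \<bar>\<theta>\<bar>"
    using r(3) by (intro cos_monotone_0_pi_le) auto
  have "sin \<bar>\<theta>\<bar> \<le> sin (pi / 4)"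
    using r(3) by (intro sin_monotone_2pi_le) auto
  with c have "sin \<bar>\<theta>\<bar> \<le> cos \<theta>"
    by (simp add: sin_45 cos_45)
  moreover have "\<bar>sin \<theta>\<bar> = sin \<bar>\<theta>\<bar>"
    using r(3) sin_ge_zero[of "\<bar>\<theta>\<bar>"] by (cases "\<theta> \<ge> 0") auto
  ultimately have y: "\<bar>Im (cinner (T y) y)\<bar> \<le> Re (cinner (T y) y)"
    using r(1,2) by (simp add: abs_mult mult_left_mono)
  have "cinner (T x) x = complex_of_real ((norm x)\<^sup>2) * cinner (T y) y"
    by (subst (1 2) x)
      (simp add: bounded_clinearD[OF T] sesquilinear power2_eq_square mult.assoc)
  then show ?thesis
    using y by (simp add: abs_mult mult_left_mono del: of_real_power)
qed

lemma norm_square_lincomb: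
  fixes x y :: "'a :: complex_inner"
  shows "(norm (a *\<^sub>C x + b *\<^sub>C y))\<^sup>2
    = (cmod a)\<^sup>2 * (norm x)\<^sup>2 + (cmod b)\<^sup>2 * (norm y)\<^sup>2 + 2 * Re (a * cnj b * cinner x y)"
proof -
  have "cinner (a *\<^sub>C x + b *\<^sub>C y) (a *\<^sub>C x + b *\<^sub>C y)
    = a * cnj a * cinner x x + b * cnj b * cinner y y
      + (a * cnj b * cinner x y + cnj (a * cnj b * cinner x y))"
    by (simp add: sesquilinear algebra_simps flip: cinner_commute)
  then show ?thesis
    unfolding norm_square_eq_Re_cinner[of "a *\<^sub>C x + b *\<^sub>C y"]
    by (simp add: cinner_self del: times_complex.sel complex_cnj_mult
        flip: complex_norm_square of_real_power of_real_mult)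
qed

lemma Re_of_real_mult: "Re (complex_of_real r * z) = r * Re z"
  by simp

text \<open>
  With \<open>U = T + T\<^sup>-\<^sup>1\<close> and \<open>q = T r\<close> the inner product is \<open>\<langle>U q, q\<rangle>\<close>.  For \<open>u\<^sup>4 + v\<^sup>4 = 1\<close> the scalar
  \<open>\<epsilon> = u\<^sup>2 \<omega> + v\<^sup>2 \<omega>\<^sup>*\<close> is unimodular with \<open>Re \<epsilon>\<^sup>2 = 2 u\<^sup>2 v\<^sup>2\<close>, and \<open>Re (\<epsilon> z) = 2 u v\<close> is a
  tangent line of the hyperbola \<open>Re z\<^sup>2 = 2\<close>.  The inequality is the sum of the two
  boundary conditions \<open>Re (\<omega> \<langle>T q, q\<rangle>) \<ge> 0\<close> and \<open>Re (\<omega>\<^sup>* \<langle>T q', q'\<rangle>) \<ge> 0\<close> of the sector, with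
  combinations \<open>q\<close>, \<open>q'\<close> of \<open>T r\<close> and \<open>r\<close> chosen so that the unwanted \<open>\<langle>T\<^sup>2 r, r\<rangle>\<close> cancels
  (because \<open>\<omega>\<^sup>2 + (\<omega>\<^sup>*)\<^sup>2 = 0\<close>).
\<close>

lemma numerical_range_add_inverse_hyperbola:
  fixes T :: "'a :: complex_inner \<Rightarrow> 'a"
  assumes T: "bounded_clinear T"
    and S: "\<And>x. \<bar>Im (cinner (T x) x)\<bar> \<le> Re (cinner (T x) x)"
  defines "\<omega> \<equiv> cis (pi / 4)"
  shows "2 * u * v * (norm (T r))\<^sup>2
    \<le> Re ((of_real (u\<^sup>2) * \<omega> + of_real (v\<^sup>2) * cnj \<omega>) * cinner (T (T r) + r) (T r))"
proof -
  have pos: "0 \<le> Re (\<omega> * cinner (T x) x)" "0 \<le> Re (cnj \<omega> * cinner (T x) x)" for x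
  proof -
    have "0 \<le> sqrt 2 / 2 * (Re (cinner (T x) x) - Im (cinner (T x) x))"
      "0 \<le> sqrt 2 / 2 * (Re (cinner (T x) x) + Im (cinner (T x) x))"
      using S[of x] by (intro mult_nonneg_nonneg; simp add: abs_le_iff)+
    then show "0 \<le> Re (\<omega> * cinner (T x) x)" "0 \<le> Re (cnj \<omega> * cinner (T x) x)"
      by (simp_all add: \<omega>_def cos_45 sin_45 right_diff_distrib distrib_left)
  qed
  define s where "s = sqrt 2 / 2"
  have s: "s * s = 1 / 2" and \<omega>: "Re \<omega> = s" "Im \<omega> = s"
    by (simp_all add: s_def \<omega>_def cos_45 sin_45)
  define p where "p = T r"
  define q where "q = complex_of_real u *\<^sub>C p - (complex_of_real v * cnj \<omega>) *\<^sub>C r"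
  define q' where "q' = complex_of_real v *\<^sub>C p - (complex_of_real u * \<omega>) *\<^sub>C r"
  define a b c d where "a = cinner (T p) p" and "b = cinner (T p) r" and "c = cinner p r"
    and "d = Re (cinner p p)"
  have ex: "cinner p p = complex_of_real d" "cinner r p = cnj c"
    by (simp_all add: d_def c_def cinner_self flip: cinner_commute)
  have "0 \<le> Re (\<omega> * cinner (T q) q) + Re (cnj \<omega> * cinner (T q') q')"
    using pos by (intro add_nonneg_nonneg)
  also have "\<dots> = Re ((of_real (u\<^sup>2) * \<omega> + of_real (v\<^sup>2) * cnj \<omega>) * (a + cnj c)) - 2 * u * v * d"
  proof -
    have Tq: "cinner (T q) q = of_real (u\<^sup>2) * a - of_real u * of_real v * \<omega> * b
        - of_real u * of_real v * cnj \<omega> * of_real d + of_real (v\<^sup>2) * (\<omega> * cnj \<omega>) * c"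
      by (simp add: q_def bounded_clinearD[OF T] sesquilinear ex power2_eq_square algebra_simps
          flip: p_def a_def b_def c_def)
    have Tq': "cinner (T q') q' = of_real (v\<^sup>2) * a - of_real u * of_real v * cnj \<omega> * b
        - of_real u * of_real v * \<omega> * of_real d + of_real (u\<^sup>2) * (\<omega> * cnj \<omega>) * c"
      by (simp add: q'_def bounded_clinearD[OF T] sesquilinear ex power2_eq_square algebra_simps
          flip: p_def a_def b_def c_def)
    have s': "s * (s * x) = x / 2" for x
      using s by (simp flip: mult.assoc)
    show ?thesis
      unfolding Tq Tq'
      by (simp add: \<omega> power2_eq_square s) (simp add: algebra_simps s')
  qed
  finally have "2 * u * v * d \<le> Re ((of_real (u\<^sup>2) * \<omega> + of_real (v\<^sup>2) * cnj \<omega>) * (a + cnj c))"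
    by (simp only: diff_ge_0_iff_ge)
  moreover have "cinner (T (T r) + r) (T r) = a + cnj c"
    by (simp only: cinner_add_left a_def ex(2) flip: p_def)
  moreover have "(norm (T r))\<^sup>2 = d"
    by (simp only: norm_square_eq_Re_cinner d_def p_def)
  ultimately show ?thesis
    by (simp only:)
qed

text \<open>
  The form \<open>\<parallel>D x\<parallel>\<^sup>2 + 8 Re \<langle>E x, T\<^sup>2 x\<rangle>\<close>, up to scaling of \<open>D\<close>, for \<open>\<eta> = \<tau> / \<bar>\<tau>\<bar>\<close>.  In the
  proof \<open>y0\<close>, \<open>y1\<close>, \<open>y2\<close> play the parts of \<open>y\<close>, \<open>U y\<close>, \<open>U\<^sup>2 y\<close>, and the tangent direction \<open>\<epsilon>\<close> is
  a square root of \<open>\<eta>\<close>: this makes the coefficient of \<open>Re \<langle>y1, y0\<rangle>\<close> in the three terms of the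
  decomposition cancel.
\<close>

lemma extremal_form_nonneg:
  fixes T :: "'a :: complex_inner \<Rightarrow> 'a"
  assumes T: "bounded_clinear T"
    and S: "\<And>x. \<bar>Im (cinner (T x) x)\<bar> \<le> Re (cinner (T x) x)"
    and \<eta>: "cmod \<eta> = 1" "Re \<eta> \<ge> 0"
  defines "E \<equiv> \<lambda>x. T (T (T (T x))) + x"
  shows "0 \<le> (norm (E x))\<^sup>2 + 4 * (norm (T (T x)))\<^sup>2
    + 4 * Re (\<eta>\<^sup>2 * cinner (E x) (T (T x))) + 8 * Re (cinner (E x) (T (T x)))"
proof -
  \<comment> \<open>\<open>u\<^sup>4\<close> and \<open>v\<^sup>4\<close> are forced: they sum to \<open>1\<close>, and \<open>\<epsilon>\<^sup>2\<close> has imaginary part \<open>u\<^sup>4 - v\<^sup>4\<close>.\<close>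
  define u where "u = sqrt (sqrt ((1 + Im \<eta>) / 2))"
  define v where "v = sqrt (sqrt ((1 - Im \<eta>) / 2))"
  define \<epsilon> where "\<epsilon> = of_real (u\<^sup>2) * cis (pi / 4) + of_real (v\<^sup>2) * cnj (cis (pi / 4))"
  define h where "h = 2 * u * v"
  have im: "\<bar>Im \<eta>\<bar> \<le> 1"
    using abs_Im_le_cmod[of \<eta>] \<eta> by simp
  have re: "(Re \<eta>)\<^sup>2 + (Im \<eta>)\<^sup>2 = 1"
    using \<eta>(1) by (simp add: cmod_power2[symmetric])
  have u2: "u\<^sup>2 = sqrt ((1 + Im \<eta>) / 2)" and v2: "v\<^sup>2 = sqrt ((1 - Im \<eta>) / 2)"
    using im by (simp_all add: u_def v_def abs_le_iff)
  have u4: "(u\<^sup>2)\<^sup>2 = (1 + Im \<eta>) / 2" and v4: "(v\<^sup>2)\<^sup>2 = (1 - Im \<eta>) / 2"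
    using im by (simp_all add: u2 v2 abs_le_iff)
  have uv: "2 * u\<^sup>2 * v\<^sup>2 = Re \<eta>"
  proof (rule power2_eq_imp_eq)
    have "(2 * u\<^sup>2 * v\<^sup>2)\<^sup>2 = 4 * ((u\<^sup>2)\<^sup>2 * (v\<^sup>2)\<^sup>2)"
      by (simp add: power_mult_distrib)
    also have "\<dots> = (Re \<eta>)\<^sup>2"
      unfolding u4 v4 using re by (simp add: algebra_simps power2_eq_square)
    finally show "(2 * u\<^sup>2 * v\<^sup>2)\<^sup>2 = (Re \<eta>)\<^sup>2" .
  qed (use \<eta> in auto)
  have \<epsilon>2: "\<epsilon>\<^sup>2 = \<eta>"
    using u4 v4 uv
    by (simp add: \<epsilon>_def complex_eq_iff power2_eq_square cos_45 sin_45 field_simps)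
  have h2: "h\<^sup>2 = 2 * Re \<eta>"
    using uv by (simp add: h_def power_mult_distrib)
  have h: "h \<ge> 0"
    using im by (simp add: h_def u_def v_def abs_le_iff)
  have hyp: "h * (norm (T r))\<^sup>2 \<le> Re (\<epsilon> * cinner (T (T r) + r) (T r))" for r
    using numerical_range_add_inverse_hyperbola[OF T S, of u v r] by (simp add: h_def \<epsilon>_def)
  have \<epsilon>1: "\<epsilon> * cnj \<epsilon> = 1"
  proof -
    have "(cmod \<epsilon>)\<^sup>2 = 1"
      using \<epsilon>2 \<eta>(1) by (metis norm_power)
    then show ?thesis
      by (simp flip: complex_norm_square)
  qed
  define y0 y1 y2 where "y0 = T (T x)" and "y1 = T (T (T x) + x)"
    and "y2 = E x + of_real 2 *\<^sub>C y0"
  note lin = bounded_clinearD[OF T]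
  have two: "of_real 2 *\<^sub>C z = z + z" for z :: 'a
    using scaleC_add_left[of 1 1 z] by simp
  have Ty1: "T y1 + (T (T x) + x) = y2"
    by (simp only: y1_def y2_def y0_def E_def lin two) simp
  have Ty0: "T y0 + T x = y1"
    by (simp add: y1_def y0_def lin)
  have h1: "0 \<le> Re (\<epsilon> * cinner y2 y1) - h * (norm y1)\<^sup>2"
    using hyp[of "T (T x) + x"] by (simp add: Ty1 flip: y1_def)
  have h0: "0 \<le> Re (\<epsilon> * cinner y1 y0) - h * (norm y0)\<^sup>2"
    using hyp[of "T x"] by (simp add: Ty0 flip: y0_def)
  define z where "z = y2 - (of_real (2 * h) * cnj \<epsilon>) *\<^sub>C y1 + (of_real (2 * h\<^sup>2) * cnj \<eta>) *\<^sub>C y0"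
  \<comment> \<open>The \<open>y1\<close>-terms cancel; the coefficients left over match because \<open>h\<^sup>2 \<eta> = \<eta>\<^sup>2 + 1\<close>.\<close>
  have "0 \<le> (norm z)\<^sup>2 + 4 * h * (Re (\<epsilon> * cinner y2 y1) - h * (norm y1)\<^sup>2)
      + 8 * h ^ 3 * (Re (\<epsilon> * cinner y1 y0) - h * (norm y0)\<^sup>2)"
    using h h0 h1 by (intro add_nonneg_nonneg mult_nonneg_nonneg) auto
  also have "\<dots> = (norm y2)\<^sup>2 + 4 * h\<^sup>2 * Re (\<eta> * cinner y2 y0) - 4 * (h\<^sup>2)\<^sup>2 * (norm y0)\<^sup>2"
  proof -
    have e: "\<epsilon> * (cnj \<epsilon> * c) = c" "cnj \<epsilon> * (\<epsilon> * c) = c" for c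
      using \<epsilon>1 by (simp_all add: mult.commute flip: mult.assoc)
    have "cinner z z = cinner y2 y2 + of_real (4 * h\<^sup>2) * cinner y1 y1
        + of_real (4 * (h\<^sup>2)\<^sup>2) * cinner y0 y0
        - of_real (2 * h) * (\<epsilon> * cinner y2 y1 + cnj \<epsilon> * cinner y1 y2)
        + of_real (2 * h\<^sup>2) * (\<eta> * cinner y2 y0 + cnj \<eta> * cinner y0 y2)
        - of_real (4 * h ^ 3) * (\<epsilon> * cinner y1 y0 + cnj \<epsilon> * cinner y0 y1)"
      unfolding z_def \<epsilon>2[symmetric]
      by (simp add: sesquilinear power2_eq_square power3_eq_cube algebra_simps e)
    moreover have "Re (cnj c * cinner x y) = Re (c * cinner y x)" for c and x y :: 'a
      by (subst cinner_commute) simp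
    ultimately have nz: "(norm z)\<^sup>2 = (norm y2)\<^sup>2 + 4 * h\<^sup>2 * (norm y1)\<^sup>2 + 4 * (h\<^sup>2)\<^sup>2 * (norm y0)\<^sup>2
        - 4 * h * Re (\<epsilon> * cinner y2 y1) + 4 * h\<^sup>2 * Re (\<eta> * cinner y2 y0)
        - 8 * h ^ 3 * Re (\<epsilon> * cinner y1 y0)"
      unfolding norm_square_eq_Re_cinner
      by (simp only: plus_complex.sel minus_complex.sel Re_of_real_mult)
        (simp only: distrib_left right_diff_distrib)
    show ?thesis
      unfolding nz by algebra
  qed
  also have "\<dots> = (norm (E x))\<^sup>2 + 4 * (norm y0)\<^sup>2
    + 4 * Re (\<eta>\<^sup>2 * cinner (E x) y0) + 8 * Re (cinner (E x) y0)"
  proof -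
    define c where "c = cinner (E x) y0"
    have "y2 = 1 *\<^sub>C E x + of_real 2 *\<^sub>C y0"
      by (simp add: y2_def)
    then have n2: "(norm y2)\<^sup>2 = (norm (E x))\<^sup>2 + 4 * (norm y0)\<^sup>2 + 4 * Re c"
      by (simp only: norm_square_lincomb) (simp add: c_def)
    have y20: "cinner y2 y0 = c + of_real (2 * (norm y0)\<^sup>2)"
      by (simp add: y2_def c_def sesquilinear cinner_self)
    have \<eta>2: "Re (\<eta>\<^sup>2) = 2 * (Re \<eta>)\<^sup>2 - 1"
      using re by (simp add: power2_eq_square)
    have i: "Im \<eta> * Im \<eta> = 1 - Re \<eta> * Re \<eta>"
      using re by (simp add: power2_eq_square)
    have "4 * h\<^sup>2 * Re (\<eta> * cinner y2 y0) = 4 * Re (\<eta>\<^sup>2 * cinner y2 y0) + 4 * Re (cinner y2 y0)"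
      unfolding h2 by (simp add: power2_eq_square i) (simp add: algebra_simps)
    also have "\<dots> = 4 * (Re (\<eta>\<^sup>2 * c) + Re (\<eta>\<^sup>2) * (2 * (norm y0)\<^sup>2)) + 4 * (Re c + 2 * (norm y0)\<^sup>2)"
      unfolding y20 distrib_left by simp
    finally have 1: "4 * h\<^sup>2 * Re (\<eta> * cinner y2 y0)
        = 4 * (Re (\<eta>\<^sup>2 * c) + Re (\<eta>\<^sup>2) * (2 * (norm y0)\<^sup>2)) + 4 * (Re c + 2 * (norm y0)\<^sup>2)" .
    show ?thesis
      unfolding 1 n2 \<eta>2 c_def[symmetric] unfolding h2 by algebra
  qed
  finally show ?thesis
    by (simp add: y0_def)
qed

text \<open>
  At \<open>\<bar>t\<bar> = 1\<close> only the square \<open>\<parallel>D x\<parallel>\<^sup>2\<close> contributes, at \<open>t = 0\<close> only the form of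
  \<open>extremal_form_nonneg\<close>; in between \<open>t\<^sup>2\<close> and \<open>1 - t\<^sup>2\<close> serve as weights.
\<close>

lemma quartic_norm_bound:
  fixes T :: "'a :: complex_inner \<Rightarrow> 'a" and t :: real
  assumes T: "bounded_clinear T"
    and S: "\<And>x. \<bar>Im (cinner (T x) x)\<bar> \<le> Re (cinner (T x) x)"
    and t: "\<bar>t\<bar> \<le> 1"
  defines "a \<equiv> \<lambda>x. T (T (T (T x))) - 2 *\<^sub>C T (T x) + x"
    and "b \<equiv> \<lambda>x. T (T (T (T x))) + 2 *\<^sub>C T (T x) + x"
  shows "norm (a x - (\<i> * t) *\<^sub>C b x) \<le> sqrt 2 * norm (b x + (\<i> * t) *\<^sub>C a x)"
proof -
  define E s where "E = T (T (T (T x))) + x" and "s = T (T x)"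
  define z where "z = cinner E s"
  define M where "M = (norm E)\<^sup>2 + 4 * (norm s)\<^sup>2"
  define \<tau> where "\<tau> = Complex 1 t"
  define \<eta> where "\<eta> = \<tau> / of_real (cmod \<tau>)"
  have \<tau>: "(cmod \<tau>)\<^sup>2 = 1 + t\<^sup>2" "\<tau> \<noteq> 0" "Re \<tau> = 1" "Im \<tau> = t"
    by (simp_all add: \<tau>_def cmod_power2 complex_eq_iff)
  have \<tau>2: "Re (\<tau>\<^sup>2 * z) = (1 - t\<^sup>2) * Re z - 2 * t * Im z"
    by (simp add: \<tau> power2_eq_square algebra_simps)
  have t2: "t\<^sup>2 \<le> 1"
    using t by (simp add: abs_square_le_1)
  have num: "a x - (\<i> * complex_of_real t) *\<^sub>C b x = cnj \<tau> *\<^sub>C E + (- 2 * \<tau>) *\<^sub>C s"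
    and den: "b x + (\<i> * t) *\<^sub>C a x = \<tau> *\<^sub>C E + (2 * cnj \<tau>) *\<^sub>C s"
  proof -
    have \<tau>': "\<tau> = 1 + \<i> * t" "cnj \<tau> = 1 - \<i> * t"
      by (simp_all add: \<tau>_def complex_eq_iff)
    have ab: "a x = 1 *\<^sub>C E + (- 2) *\<^sub>C s" "b x = 1 *\<^sub>C E + 2 *\<^sub>C s"
      by (simp_all add: a_def b_def E_def s_def)
    have comb: "(p *\<^sub>C E + q *\<^sub>C s) + r *\<^sub>C (p' *\<^sub>C E + q' *\<^sub>C s) = (p + r * p') *\<^sub>C E + (q + r * q') *\<^sub>C s"
      for p q r p' q'
      by (simp add: scaleC_add_right scaleC_scaleC scaleC_add_left)
    show "a x - (\<i> * complex_of_real t) *\<^sub>C b x = cnj \<tau> *\<^sub>C E + (- 2 * \<tau>) *\<^sub>C s"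
      "b x + (\<i> * t) *\<^sub>C a x = \<tau> *\<^sub>C E + (2 * cnj \<tau>) *\<^sub>C s"
      unfolding ab \<tau>' diff_conv_add_uminus scaleC_minus_left[symmetric] comb
      by (simp_all add: algebra_simps)
  qed
  have numn: "(norm (a x - (\<i> * t) *\<^sub>C b x))\<^sup>2 = (1 + t\<^sup>2) * M - 4 * Re ((cnj \<tau>)\<^sup>2 * z)"
    unfolding num norm_square_lincomb norm_mult power_mult_distrib complex_mod_cnj \<tau>(1)
    by (simp add: \<tau> M_def z_def power2_eq_square algebra_simps)
  have denn: "(norm (b x + (\<i> * t) *\<^sub>C a x))\<^sup>2 = (1 + t\<^sup>2) * M + 4 * Re (\<tau>\<^sup>2 * z)"
    unfolding den norm_square_lincomb norm_mult power_mult_distrib complex_mod_cnj \<tau>(1)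
    by (simp add: \<tau> M_def z_def power2_eq_square algebra_simps)
  define W where "W = Re (\<tau>\<^sup>2 * z)"
  have pos: "0 < 1 + t\<^sup>2"
    by (rule add_pos_nonneg) simp_all
  have "0 \<le> M + 4 * Re (\<eta>\<^sup>2 * z) + 8 * Re z"
    using extremal_form_nonneg[OF T S, of \<eta> x] \<tau> by (simp add: \<eta>_def norm_divide M_def z_def E_def s_def)
  moreover have "\<eta>\<^sup>2 * z = \<tau>\<^sup>2 * z / of_real (1 + t\<^sup>2)"
    unfolding \<eta>_def power_divide of_real_power[symmetric] \<tau>(1) by (rule times_divide_eq_left)
  then have "Re (\<eta>\<^sup>2 * z) = W / (1 + t\<^sup>2)"
    unfolding W_def by (simp only: Re_divide_of_real)
  ultimately have "0 \<le> M + 4 * (W / (1 + t\<^sup>2)) + 8 * Re z"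
    by (simp only:)
  then have "0 \<le> (1 + t\<^sup>2) * (M + 4 * (W / (1 + t\<^sup>2)) + 8 * Re z)"
    using pos by (intro mult_nonneg_nonneg) auto
  also have "\<dots> = (1 + t\<^sup>2) * M + 4 * W + 8 * (1 + t\<^sup>2) * Re z"
    using pos by (simp add: field_simps)
  finally have core: "0 \<le> (1 + t\<^sup>2) * M + 4 * W + 8 * (1 + t\<^sup>2) * Re z" .
  define m n where "m = norm (b x + (\<i> * t) *\<^sub>C a x)" and "n = norm (a x - (\<i> * t) *\<^sub>C b x)"
  have m: "m\<^sup>2 = (1 + t\<^sup>2) * M + 4 * W"
    using denn by (simp only: m_def W_def)
  have "Re ((cnj \<tau>)\<^sup>2 * z) = 2 * (1 - t\<^sup>2) * Re z - W"
    unfolding W_def \<tau>2 by (simp add: \<tau> power2_eq_square algebra_simps)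
  then have n: "n\<^sup>2 = (1 + t\<^sup>2) * M + 4 * W - 8 * (1 - t\<^sup>2) * Re z"
    using numn by (simp add: n_def)
  have "0 \<le> 2 * t\<^sup>2 * m\<^sup>2 + (1 - t\<^sup>2) * ((1 + t\<^sup>2) * M + 4 * W + 8 * (1 + t\<^sup>2) * Re z)"
    by (rule add_nonneg_nonneg[OF mult_nonneg_nonneg mult_nonneg_nonneg[OF _ core]]) (use t2 in auto)
  also have "\<dots> = (1 + t\<^sup>2) * (2 * m\<^sup>2 - n\<^sup>2)"
    unfolding m n by (simp add: algebra_simps)
  finally have "(1 + t\<^sup>2) * 0 \<le> (1 + t\<^sup>2) * (2 * m\<^sup>2 - n\<^sup>2)"
    by (simp only: mult_zero_right)
  then have "0 \<le> 2 * m\<^sup>2 - n\<^sup>2"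
    using pos by (rule mult_left_le_imp_le)
  then have "n\<^sup>2 \<le> 2 * m\<^sup>2"
    by (simp only: diff_ge_0_iff_ge)
  then have "n\<^sup>2 \<le> (sqrt 2 * m)\<^sup>2"
    by (simp add: power_mult_distrib)
  then have "n \<le> sqrt 2 * m"
    by (rule power2_le_imp_le) (simp add: m_def)
  then show ?thesis
    by (simp only: m_def n_def)
qed

section \<open>Invertibility\<close>

text \<open>
  Lax--Milgram for an operator on the space itself: for small \<open>\<rho>\<close> the map \<open>x \<mapsto> x - \<rho> (B x - y)\<close> is a
  contraction, and its fixed point solves \<open>B x = y\<close>.
\<close>

lemma bij_if_coercive:
  fixes B :: "'a :: {real_inner, complete_space} \<Rightarrow> 'a"
  assumes B: "bounded_linear B" and \<delta>: "\<delta> > 0" and co: "\<And>x. \<delta> * (norm x)\<^sup>2 \<le> inner (B x) x"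
  shows "bij B"
proof -
  interpret bounded_linear B by fact
  obtain K0 where K0: "\<And>x. norm (B x) \<le> norm x * K0"
    using bounded by blast
  define K where "K = max K0 \<delta>"
  have K: "norm (B x) \<le> K * norm x" for x
    using K0[of x] mult_left_mono[of K0 K "norm x"] by (simp add: K_def mult.commute)
  have K\<delta>: "\<delta> \<le> K" "K > 0"
    using \<delta> by (auto simp: K_def)
  \<comment> \<open>This \<open>\<rho>\<close> minimises \<open>1 - 2 \<rho> \<delta> + \<rho>\<^sup>2 K\<^sup>2\<close>, the bound for the square of the Lipschitz constant.\<close>
  define \<rho> where "\<rho> = \<delta> / K\<^sup>2"
  define q where "q = sqrt (1 - \<delta>\<^sup>2 / K\<^sup>2)"
  have "\<delta>\<^sup>2 / K\<^sup>2 \<le> 1" "\<delta>\<^sup>2 / K\<^sup>2 > 0"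
    using K\<delta> \<delta> by (simp_all add: power_mono)
  then have q: "0 \<le> q" "q < 1" and q2: "q\<^sup>2 = 1 - \<delta>\<^sup>2 / K\<^sup>2"
    by (simp_all add: q_def)
  have contr: "norm (x - \<rho> *\<^sub>R B x) \<le> q * norm x" for x
  proof (rule power2_le_imp_le)
    have "(norm (x - \<rho> *\<^sub>R B x))\<^sup>2 = (norm x)\<^sup>2 - 2 * \<rho> * inner (B x) x + \<rho>\<^sup>2 * (norm (B x))\<^sup>2"
      unfolding power2_norm_eq_inner
      by (simp add: inner_diff_left inner_diff_right inner_commute power2_eq_square algebra_simps)
    also have "\<dots> \<le> (norm x)\<^sup>2 - 2 * \<rho> * (\<delta> * (norm x)\<^sup>2) + \<rho>\<^sup>2 * (K * norm x)\<^sup>2"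
      using co[of x] K[of x] \<delta> K\<delta>
      by (intro add_mono diff_mono mult_left_mono power_mono) (auto simp: \<rho>_def)
    also have "\<dots> = (q * norm x)\<^sup>2"
      using K\<delta> unfolding power_mult_distrib q2 \<rho>_def by (simp add: field_simps power2_eq_square)
    finally show "(norm (x - \<rho> *\<^sub>R B x))\<^sup>2 \<le> (q * norm x)\<^sup>2" .
  qed (use q in auto)
  have "\<exists>!x. B x = y" for y
  proof -
    have "\<exists>!x. x - \<rho> *\<^sub>R (B x - y) = x"
    proof (rule banach_fix_type[OF q], intro allI)
      fix x x'
      have "(x - \<rho> *\<^sub>R (B x - y)) - (x' - \<rho> *\<^sub>R (B x' - y)) = (x - x') - \<rho> *\<^sub>R B (x - x')"
        by (simp add: diff algebra_simps)
      then show "dist (x - \<rho> *\<^sub>R (B x - y)) (x' - \<rho> *\<^sub>R (B x' - y)) \<le> q * dist x x'"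
        using contr[of "x - x'"] by (simp only: dist_norm)
    qed
    then show ?thesis
      using \<delta> K\<delta> by (simp add: \<rho>_def)
  qed
  then show ?thesis
    by (simp add: bij_iff)
qed

lemma bounded_invertible_if_coercive:
  fixes B :: "'a :: chilbert_space \<Rightarrow> 'a"
  assumes B: "bounded_clinear B" and \<delta>: "\<delta> > 0"
    and co: "\<And>x. \<delta> * (norm x)\<^sup>2 \<le> Re (cinner (B x) x)"
  shows "bounded_invertible B"
proof -
  have bij: "bij B"
    using B \<delta> co by (intro bij_if_coercive) (auto simp: bounded_clinear_def Re_cinner)
  have below: "\<delta> * norm x \<le> norm (B x)" for x
  proof (cases "x = 0")
    case False
    have "\<delta> * norm x * norm x \<le> norm (B x) * norm x"
      using co[of x] norm_cauchy_schwarz[of "B x" x]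
      by (simp add: Re_cinner power2_eq_square mult.assoc)
    then show ?thesis
      using False by simp
  qed simp
  have inv: "B (inv B y) = y" "inv B (B x) = x" for x y
    using bij by (simp_all add: bij_is_surj surj_f_inv_f bij_is_inj)
  have add: "inv B (x + y) = inv B x + inv B y" for x y
    using inv(2)[of "inv B x + inv B y"] by (simp add: bounded_clinearD[OF B] inv(1))
  have scale: "inv B (c *\<^sub>C x) = c *\<^sub>C inv B x" for c x
    using inv(2)[of "c *\<^sub>C inv B x"] by (simp add: bounded_clinearD[OF B] inv(1))
  have "bounded_linear (inv B)"
  proof (rule bounded_linear_intro[where K = "1 / \<delta>"])
    show "norm (inv B y) \<le> norm y * (1 / \<delta>)" for y
      using below[of "inv B y"] \<delta> by (simp add: inv(1) field_simps)
  qed (simp_all add: add scale scaleR_scaleC)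
  then show ?thesis
    using B bij scale by (simp add: bounded_invertible_def bounded_clinear_def)
qed

lemma bounded_invertible_comp:
  assumes "bounded_invertible A" "bounded_invertible B"
  shows "bounded_invertible (A \<circ> B)"
  using assms by (simp add: bounded_invertible_def bij_comp o_inv_distrib bounded_clinear_compose)

lemma bounded_clinear_add:
  assumes "bounded_clinear A" "bounded_clinear B"
  shows "bounded_clinear (\<lambda>x. A x + B x)"
  using assms by (simp add: bounded_clinear_def bounded_linear_add scaleC_add_right)

lemma poly_op_diff:
  assumes "bounded_clinear A"
  shows "poly_op (p - q) A x = poly_op p A x - poly_op q A x"
  using poly_op_add[OF assms, of "p - q" q x] by simp

lemma bounded_clinear_poly_op:
  assumes A: "bounded_clinear A"
  shows "bounded_clinear (poly_op p A)"
proof (induction p)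
  case 0
  then show ?case
    using bounded_linear_zero by (simp add: bounded_clinear_def poly_op_def)
next
  case (pCons a p)
  have "poly_op (pCons a p) A = (\<lambda>x. a *\<^sub>C x + (A \<circ> poly_op p A) x)"
    by (simp add: poly_op_pCons[OF A] fun_eq_iff)
  moreover have "bounded_clinear (A \<circ> poly_op p A)"
    by (rule bounded_clinear_compose[OF A pCons.IH])
  ultimately show ?case
    using bounded_clinear_add[OF bounded_clinear_scaleC[of a]] by metis
qed

text \<open>
  Split off one root \<open>\<zeta>\<close> at a time.  A point outside the sector lies strictly beyond one of its two
  sides, say \<open>Re ((1 + \<i> \<sigma>) \<zeta>) < 0\<close> with \<open>\<sigma> = \<plusminus>1\<close>, while \<open>(1 + \<i> \<sigma>) T\<close> is accretive, so
  \<open>(1 + \<i> \<sigma>) (T - \<zeta>)\<close> is coercive.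
\<close>

lemma bounded_invertible_poly_op:
  fixes T :: "'a :: chilbert_space \<Rightarrow> 'a"
  assumes T: "bounded_clinear T"
    and S: "\<And>x. \<bar>Im (cinner (T x) x)\<bar> \<le> Re (cinner (T x) x)"
    and roots: "\<And>z. \<bar>Im z\<bar> \<le> Re z \<Longrightarrow> poly p z \<noteq> 0"
  shows "bounded_invertible (poly_op p T)"
  using roots
proof (induction "degree p" arbitrary: p)
  case 0
  then obtain a where p: "p = [:a:]"
    using degree_eq_zeroE by metis
  then have a: "a \<noteq> 0"
    using "0.prems"[of 1] by auto
  have "bounded_invertible (id :: 'a \<Rightarrow> 'a)"
    by (simp add: bounded_invertible_def bounded_clinear_def bounded_linear_ident[unfolded id_def[symmetric]])
  then show ?case
    using bounded_invertible_scaleC[OF a, of id]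
    by (simp add: p poly_op_pCons[OF T] bounded_clinearD[OF T] id_def)
next
  case (Suc n)
  have "\<not> constant (poly p)"
    using Suc.hyps(2) by (simp add: constant_degree)
  then obtain \<zeta> where \<zeta>: "poly p \<zeta> = 0"
    using fundamental_theorem_of_algebra by blast
  then obtain r where p: "p = [:- \<zeta>, 1:] * r"
    by (meson poly_eq_0_iff_dvd dvdE)
  have "r \<noteq> 0"
    using p Suc.hyps(2) by auto
  then have r: "n = degree r"
    using Suc.hyps(2) unfolding p by (subst (asm) degree_mult_eq) auto
  have "poly r z \<noteq> 0" if "\<bar>Im z\<bar> \<le> Re z" for z
    using Suc.prems[OF that] by (simp add: p)
  then have inv_r: "bounded_invertible (poly_op r T)"
    by (rule Suc.hyps(1)[OF r])
  have "\<not> \<bar>Im \<zeta>\<bar> \<le> Re \<zeta>"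
    using \<zeta> Suc.prems by blast
  then obtain \<sigma> :: real where \<sigma>: "\<bar>\<sigma>\<bar> = 1" "Re \<zeta> < \<sigma> * Im \<zeta>"
    by (metis abs_1 abs_if abs_minus_cancel mult_1 mult_minus1 not_le)
  define c where "c = Complex 1 \<sigma>"
  define L where "L = poly_op [:- \<zeta>, 1:] T"
  have L: "L x = T x - \<zeta> *\<^sub>C x" for x
    by (simp add: L_def poly_op_pCons[OF T] bounded_clinearD[OF T])
  have "bounded_invertible (\<lambda>x. c *\<^sub>C L x)"
  proof (rule bounded_invertible_if_coercive)
    show "bounded_clinear (\<lambda>x. c *\<^sub>C L x)"
      using bounded_clinear_compose[OF bounded_clinear_scaleC bounded_clinear_poly_op[OF T]]
      by (simp add: L_def o_def)
    show "0 < \<sigma> * Im \<zeta> - Re \<zeta>"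
      using \<sigma> by simp
    show "(\<sigma> * Im \<zeta> - Re \<zeta>) * (norm x)\<^sup>2 \<le> Re (cinner (c *\<^sub>C L x) x)" for x
    proof -
      have "cinner (c *\<^sub>C L x) x = c * (cinner (T x) x - \<zeta> * of_real ((norm x)\<^sup>2))"
        by (simp add: L cinner_scaleC_left cinner_diff_left cinner_self)
      moreover have "\<sigma> * Im (cinner (T x) x) \<le> Re (cinner (T x) x)"
        using S[of x] \<sigma>(1) by (auto simp: abs_if split: if_splits)
      ultimately show ?thesis
        by (simp only: c_def) (simp add: algebra_simps)
    qed
  qed
  moreover have "c \<noteq> 0"
    by (simp add: c_def complex_eq_iff)
  ultimately have "bounded_invertible L"
    using bounded_invertible_scaleC[of "inverse c" "\<lambda>x. c *\<^sub>C L x"] by (simp add: scaleC_scaleC)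
  moreover have "poly_op p T = L \<circ> poly_op r T"
    unfolding p L_def by (rule ext) (simp only: poly_op_mult[OF T] o_apply)
  ultimately show ?case
    using bounded_invertible_comp[OF _ inv_r] by metis
qed

section \<open>From quadratic inequalities to rational functions\<close>

lemma rat_op_bound:
  assumes co: "coprime p q" and q: "q \<noteq> 0" and A: "bounded_clinear A"
    and inv: "bounded_invertible (poly_op q A)" and C: "C \<ge> 0"
    and bound: "\<And>x. norm (poly_op p A x) \<le> C * norm (poly_op q A x)"
  shows "rat_op_defined (Fract p q) A \<and> onorm (rat_op (Fract p q) A) \<le> C"
proof
  show "rat_op_defined (Fract p q) A"
    using rat_op_defined_coprime[OF co q] inv by blast
  have "poly_op q A (Hilbert_Choice.inv (poly_op q A) y) = y" for y
    using inv by (simp add: bounded_invertible_def bij_is_surj surj_f_inv_f)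
  then show "onorm (rat_op (Fract p q) A) \<le> C"
    unfolding rat_op_coprime[OF co q A inv] using bound C
    by (intro onorm_bound) (metis o_apply)+
qed

text \<open>
  Both rational functions of the theorem have this form: in the variable of \<open>T\<close> with
  \<open>a = (z\<^sup>2 - 1)\<^sup>2\<close> and \<open>b = (z\<^sup>2 + 1)\<^sup>2\<close>, in the variable of \<open>w\<close> with \<open>a = z\<^sup>2\<close> and \<open>b = 1\<close>.  For \<open>\<bar>t\<bar> = 1\<close> the
  quotient is the constant \<open>- \<i> t\<close>, and the denominator before cancelling need not be invertible.
\<close>

lemma rat_op_bound_quartic:
  fixes A :: "'a :: complex_inner \<Rightarrow> 'a" and a b :: "complex poly" and t :: real
  assumes co: "coprime a b" and t: "\<bar>t\<bar> \<le> 1" and A: "bounded_clinear A"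
    and nz: "b + smult (\<i> * t) a \<noteq> 0"
    and inv: "\<bar>t\<bar> < 1 \<Longrightarrow> bounded_invertible (poly_op (b + smult (\<i> * t) a) A)"
    and bound: "\<And>x. norm (poly_op (a - smult (\<i> * t) b) A x)
      \<le> sqrt 2 * norm (poly_op (b + smult (\<i> * t) a) A x)"
  defines "R \<equiv> Fract (a - smult (\<i> * t) b) (b + smult (\<i> * t) a)"
  shows "rat_op_defined R A \<and> onorm (rat_op R A) \<le> sqrt 2"
proof (cases "\<bar>t\<bar> < 1")
  case True
  then show ?thesis
    unfolding R_def using rat_op_bound[OF quartics_coprime[OF co True] nz A inv[OF True] _ bound] by simp
next
  case False
  then have t: "t\<^sup>2 = 1" "\<bar>t\<bar> = 1"
    using t by (auto simp: abs_if power2_eq_1_iff split: if_splits)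
  have "bounded_invertible (id :: 'a \<Rightarrow> 'a)"
    by (simp add: bounded_invertible_def bounded_clinear_def bounded_linear_ident[unfolded id_def[symmetric]])
  then have "rat_op_defined (Fract [:- \<i> * t:] 1) A \<and> onorm (rat_op (Fract [:- \<i> * t:] 1) A) \<le> sqrt 2"
    using t mult_right_mono[of 1 "sqrt 2", OF _ norm_ge_zero] by (intro rat_op_bound A)
      (simp_all add: poly_op_pCons[OF A] bounded_clinearD[OF A] norm_scaleC norm_mult)
  then show ?thesis
    unfolding R_def quartics_unit_circle[OF nz t(1)] .
qed

theorem theorem1p5:
  fixes T :: "'a :: chilbert_space \<Rightarrow> 'a" and t :: real
  assumes "bounded_clinear T"
    and "numerical_range T \<subseteq> sector (pi / 4)"
    and "- 1 \<le> t" and "t \<le> 1"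
  shows "(let z = [:0, 1:] :: complex poly;
              R = Fract ((z\<^sup>2 - 1)\<^sup>2 - smult (\<i> * t) ((z\<^sup>2 + 1)\<^sup>2))
                        ((z\<^sup>2 + 1)\<^sup>2 + smult (\<i> * t) ((z\<^sup>2 - 1)\<^sup>2))
          in rat_op_defined R T \<and> onorm (rat_op R T) \<le> sqrt 2)
       \<and> bounded_invertible (\<lambda>x. T (T x) + x)
       \<and> (let w = (\<lambda>x. T (T x) - x) \<circ> inv (\<lambda>x. T (T x) + x)
          in rat_op_defined (h_fract (\<i> * t)) w \<and> onorm (rat_op (h_fract (\<i> * t)) w) \<le> sqrt 2)"
proof -
  have t: "\<bar>t\<bar> \<le> 1"
    using assms(3,4) by simp
  note T = assms(1)
  note S = abs_Im_le_Re_if_numerical_range_sector[OF T assms(2)]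
  note lin = bounded_clinearD[OF T]
  define z :: "complex poly" where "z = [:0, 1:]"
  define A B where "A = poly_op (z\<^sup>2 - 1) T" and "B = poly_op (z\<^sup>2 + 1) T"
  define N where "N = poly_op ((z\<^sup>2 - 1)\<^sup>2 - smult (\<i> * t) ((z\<^sup>2 + 1)\<^sup>2)) T"
  define D where "D = poly_op ((z\<^sup>2 + 1)\<^sup>2 + smult (\<i> * t) ((z\<^sup>2 - 1)\<^sup>2)) T"
  have z2: "z\<^sup>2 - 1 = [:-1, 0, 1:]" "z\<^sup>2 + 1 = [:1, 0, 1:]"
    by (simp_all add: z_def power2_eq_square one_pCons)
  have A: "A = (\<lambda>x. T (T x) - x)" and B: "B = (\<lambda>x. T (T x) + x)"
    by (simp_all add: A_def B_def z2 poly_op_pCons[OF T] lin fun_eq_iff)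
  have AA: "poly_op ((z\<^sup>2 - 1)\<^sup>2) T x = A (A x)" and BB: "poly_op ((z\<^sup>2 + 1)\<^sup>2) T x = B (B x)" for x
    by (simp_all add: A_def B_def power2_eq_square poly_op_mult[OF T])
  have N: "N x = A (A x) - (\<i> * t) *\<^sub>C B (B x)" for x
    by (simp add: N_def poly_op_diff[OF T] poly_op_smult AA BB)
  have D: "D x = B (B x) + (\<i> * t) *\<^sub>C A (A x)" for x
    by (simp add: D_def poly_op_add[OF T] poly_op_smult AA BB)
  have two: "2 *\<^sub>C x = x + x" for x :: 'a
    using scaleC_add_left[of 1 1 x] by simp
  have bound: "norm (N x) \<le> sqrt 2 * norm (D x)" for x
    using quartic_norm_bound[OF T S t, of x]
    by (simp add: N D A B lin two algebra_simps)
  have Re2: "Re (w\<^sup>2) \<ge> 0" if "\<bar>Im w\<bar> \<le> Re w" for w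
    using abs_le_square_iff[of "Im w" "Re w"] that by (simp add: power2_eq_square)
  have sq: "w\<^sup>2 + 1 \<noteq> 0" if "\<bar>Im w\<bar> \<le> Re w" for w
    using Re2[OF that] by (auto simp: complex_eq_iff)
  have invB: "bounded_invertible B"
    unfolding B_def using sq by (intro bounded_invertible_poly_op T S) (auto simp: z_def)
  have invD: "bounded_invertible D" if t1: "\<bar>t\<bar> < 1"
    unfolding D_def
  proof (intro bounded_invertible_poly_op T S)
    fix w assume w: "\<bar>Im w\<bar> \<le> Re w"
    \<comment> \<open>\<open>w\<^sup>2\<close> lies in the right half plane, closer to \<open>1\<close> than to \<open>-1\<close>; as \<open>\<bar>t\<bar> < 1\<close> the first square dominates.\<close>
    have le: "(cmod (w\<^sup>2 - 1))\<^sup>2 \<le> (cmod (w\<^sup>2 + 1))\<^sup>2"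
      using Re2[OF w] unfolding cmod_power2 by (simp add: power2_eq_square algebra_simps)
    have pos: "0 < cmod (w\<^sup>2 + 1) ^ 2"
      using sq[OF w] by simp
    have "cmod ((\<i> * t) * (w\<^sup>2 - 1)\<^sup>2) = \<bar>t\<bar> * cmod (w\<^sup>2 - 1) ^ 2"
      by (simp add: norm_mult norm_power)
    also have "\<dots> \<le> \<bar>t\<bar> * cmod (w\<^sup>2 + 1) ^ 2"
      using le by (intro mult_left_mono) auto
    also have "\<dots> < cmod ((w\<^sup>2 + 1)\<^sup>2)"
      using t1 pos by (simp add: norm_power)
    finally have "(w\<^sup>2 + 1)\<^sup>2 + (\<i> * t) * (w\<^sup>2 - 1)\<^sup>2 \<noteq> 0"
      by (metis add_eq_0_iff norm_minus_cancel less_irrefl)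
    then show "poly ((z\<^sup>2 + 1)\<^sup>2 + smult (\<i> * t) ((z\<^sup>2 - 1)\<^sup>2)) w \<noteq> 0"
      by (simp add: z_def)
  qed
  have "coprime (z\<^sup>2 - 1) (z\<^sup>2 + 1)"
  proof (rule coprimeI)
    fix d assume "d dvd z\<^sup>2 - 1" "d dvd z\<^sup>2 + 1"
    then have "d dvd (z\<^sup>2 + 1) - (z\<^sup>2 - 1)"
      by (rule dvd_diff[rotated])
    also have "(z\<^sup>2 + 1) - (z\<^sup>2 - 1) = [:2 :: complex:]"
      by (simp add: z2)
    finally show "is_unit d"
      by (rule dvd_trans) (simp add: is_unit_const_poly_iff dvd_field_iff)
  qed
  then have co: "coprime ((z\<^sup>2 - 1)\<^sup>2) ((z\<^sup>2 + 1)\<^sup>2)"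
    by simp
  have poly_neq: "p \<noteq> 0" if "poly p 0 \<noteq> 0" for p :: "complex poly"
    using that by auto
  have part1: "rat_op_defined R T \<and> onorm (rat_op R T) \<le> sqrt 2"
    if "R = Fract ((z\<^sup>2 - 1)\<^sup>2 - smult (\<i> * t) ((z\<^sup>2 + 1)\<^sup>2)) ((z\<^sup>2 + 1)\<^sup>2 + smult (\<i> * t) ((z\<^sup>2 - 1)\<^sup>2))" for R
    unfolding that
  proof (rule rat_op_bound_quartic[OF co t T])
    show "(z\<^sup>2 + 1)\<^sup>2 + smult (\<i> * t) ((z\<^sup>2 - 1)\<^sup>2) \<noteq> 0"
      by (rule poly_neq) (simp add: z_def complex_eq_iff)
  qed (use invD bound in \<open>simp_all add: N_def D_def\<close>)
  define B' w where "B' = inv B" and "w = A \<circ> B'"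
  have B': "B (B' x) = x" "B' (B x) = x" "bij B" "bounded_clinear B'" for x
    using invB by (simp_all add: B'_def bounded_invertible_def bij_is_surj surj_f_inv_f bij_is_inj)
  have "bounded_clinear A"
    unfolding A_def by (rule bounded_clinear_poly_op[OF T])
  with B' have w: "bounded_clinear w"
    by (simp add: w_def bounded_clinear_compose)
  have "A (B x) = B (A x)" for x
    by (simp add: A B lin algebra_simps)
  then have comm: "B' (A x) = A (B' x)" for x
    by (metis B'(1,2))
  have ww: "w (w x) = A (A (B' (B' x)))" for x
    by (simp add: w_def comm)
  have num: "poly_op (z\<^sup>2 - smult (\<i> * t) 1) w x = N (B' (B' x))" for x
  proof -
    have "z\<^sup>2 - smult (\<i> * t) 1 = [:- \<i> * t, 0, 1:]"
      by (simp add: z_def power2_eq_square)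
    then show ?thesis
      by (simp add: poly_op_pCons[OF w] bounded_clinearD[OF w] ww N B'(1))
  qed
  have den: "poly_op (1 + smult (\<i> * t) (z\<^sup>2)) w x = D (B' (B' x))" for x
  proof -
    have "1 + smult (\<i> * t) (z\<^sup>2) = [:1, 0, \<i> * t:]"
      by (simp add: z_def power2_eq_square one_pCons)
    then show ?thesis
      by (simp add: poly_op_pCons[OF w] bounded_clinearD[OF w] ww D B'(1))
  qed
  have part3: "rat_op_defined (h_fract (\<i> * t)) w \<and> onorm (rat_op (h_fract (\<i> * t)) w) \<le> sqrt 2"
  proof -
    have h: "h_fract (\<i> * t) = Fract (z\<^sup>2 - smult (\<i> * t) 1) (1 + smult (\<i> * t) (z\<^sup>2))"
      by (simp add: h_fract_def z_def Let_def power2_eq_square)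
    show ?thesis
      unfolding h
    proof (rule rat_op_bound_quartic[OF _ t w])
      show "1 + smult (\<i> * t) (z\<^sup>2) \<noteq> 0"
        by (rule poly_neq) (simp add: z_def)
      show "bounded_invertible (poly_op (1 + smult (\<i> * t) (z\<^sup>2)) w)" if "\<bar>t\<bar> < 1"
      proof -
        have "inv B' = B"
          using B' by (intro inv_equality) auto
        moreover have "bij B'"
          using B' by (simp add: B'_def bij_imp_bij_inv)
        ultimately have "bounded_invertible B'"
          using B' invB by (simp add: bounded_invertible_def)
        moreover have "poly_op (1 + smult (\<i> * t) (z\<^sup>2)) w = D \<circ> (B' \<circ> B')"
          by (simp add: fun_eq_iff den)
        ultimately show ?thesis
          using invD[OF that] by (simp add: bounded_invertible_comp)
      qed
    qed (simp_all only: num den bound coprime_1_right)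
  qed
  have w_eq: "(\<lambda>x. T (T x) - x) \<circ> inv B = w"
    by (simp only: w_def B'_def A)
  show ?thesis
    unfolding Let_def z_def[symmetric] B[symmetric] w_eq
    using part1[OF refl] invB part3 by (intro conjI) auto
qed

end
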